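(* Suppose that for every $x\in\mathcal{X}$ and $A\in\mathcal{B}(\mathcal{X})$ the map $u\mapsto Q(A|x,u)$ is continuous on $\mathcal{U}$. Let $k\in\{0,\dots,T-1\}$, let $V^*_{k+1}$ and $V^*_k$ be the reach-avoid value functions at steps $k+1$ and $k$, and let $\nu$ be a finite non-negative measure supported on $\bar{\mathcal{X}}$. Consider the infinite dimensional linear program $$\inf_{V\in\mathcal{F}}\ \int_{\bar{\mathcal{X}}}V(x)\,\nu(dx)\quad\text{subject to}\quad V(x)\ge \mathcal{T}_u[V^*_{k+1}](x)\quad\forall (x,u)\in\bar{\mathcal{X}}\times\mathcal{U}.$$ Then: (a) any feasible $V$ of this program is an upper bound on the optimal reach-avoid value function on $\bar{\mathcal{X}}$, i.e. $V(x)\ge V^*_k(x)$ for all $x\in\bar{\mathcal{X}}$; (b) $V^*_k$ is an optimal solution of this program, and any other optimal solution is equal to $V^*_k$ $\nu$-almost everywhere on $\bar{\mathcal{X}}$.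
   Context: Setting: $\mathcal{X}\subseteq\mathbb{R}^n$ is the state space with Borel $\sigma$-algebra $\mathcal{B}(\mathcal{X})$; $\mathcal{U}\subseteq\mathbb{R}^m$ is a nonempty compact control space. $Q$ is a Borel-measurable stochastic kernel on $\mathcal{X}$ given $\mathcal{X}\times\mathcal{U}$: $Q(A|\cdot)$ is Borel measurable on $\mathcal{X}\times\mathcal{U}$ for each $A\in\mathcal{B}(\mathcal{X})$ and $Q(\cdot|x,u)$ is a probability measure on $\mathcal{X}$ for each $(x,u)$. "Measurable" means Borel measurable. $K\subseteq K'$ are Borel subsets of $\mathcal{X}$ (target set and safe set) and $\bar{\mathcal{X}}:=K'\setminus K$. $T\in\mathbb{N}$ is the time horizon, and $\mathds{1}_A$ denotes the indicator function of a set $A$. Value functions $V^*_k:\mathcal{X}\to[0,1]$, $k=T,T-1,\dots,0$, are defined by $$V^*_T(x)=\mathds{1}_K(x),\qquad V^*_k(x)=\sup_{u\in\mathcal{U}}\Big\{\mathds{1}_K(x)+\mathds{1}_{\bar{\mathcal{X}}}(x)\int_{\mathcal{X}}V^*_{k+1}(y)\,Q(dy|x,u)\Big\}.$$ $\mathcal{F}:=\{f:\mathcal{X}\to\mathbb{R}: f\text{ measurable}\}$, and $\mathcal{T}_u[V](x):=\int_{\mathcal{X}}V(y)\,Q(dy|x,u)$. *)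

theory Defs
  imports "HOL-Probability.Probability"
begin

abbreviation borel_on :: "'a::topological_space set \<Rightarrow> 'a measure" where
  "borel_on X \<equiv> restrict_space borel X"

definition stochastic_kernel ::
  "(real^'n) set \<Rightarrow> (real^'m) set \<Rightarrow> (real^'n \<Rightarrow> real^'m \<Rightarrow> (real^'n) measure) \<Rightarrow> bool" where
  "stochastic_kernel X U Q \<longleftrightarrow>
     (\<forall>x\<in>X. \<forall>u\<in>U. prob_space (Q x u) \<and> sets (Q x u) = sets (borel_on X)) \<and>
     (\<forall>A\<in>sets (borel_on X).
        (\<lambda>(x, u). measure (Q x u) A) \<in> borel_measurable (borel_on (X \<times> U)))"

definition transition_op ::
  "(real^'n \<Rightarrow> real^'m \<Rightarrow> (real^'n) measure) \<Rightarrow> real^'m \<Rightarrow> (real^'n \<Rightarrow> real) \<Rightarrow> real^'n \<Rightarrow> real" where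
  "transition_op Q u V x = (\<integral>y. V y \<partial>(Q x u))"

(* Backward recursion from the horizon T; only the values for k \<le> T and x \<in> X are meaningful. *)
function reach_avoid_value ::
  "(real^'m) set \<Rightarrow> (real^'n \<Rightarrow> real^'m \<Rightarrow> (real^'n) measure) \<Rightarrow>
   (real^'n) set \<Rightarrow> (real^'n) set \<Rightarrow> nat \<Rightarrow> nat \<Rightarrow> real^'n \<Rightarrow> real" where
  "reach_avoid_value U Q K K' T k =
     (if k < T
      then (\<lambda>x. SUP u\<in>U. indicator K x +
              indicator (K' - K) x * transition_op Q u (reach_avoid_value U Q K K' T (Suc k)) x)
      else indicator K)"
  by pat_completeness auto
termination
  by (relation "Wellfounded.measure (\<lambda>(U, Q, K, K', T, k). T - k)") auto

declare reach_avoid_value.simps [simp del]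

lemma reach_avoid_value_horizon: "reach_avoid_value U Q K K' T T x = indicator K x"
  by (simp add: reach_avoid_value.simps)

lemma reach_avoid_value_step:
  "k < T \<Longrightarrow> reach_avoid_value U Q K K' T k x =
     (SUP u\<in>U. indicator K x +
        indicator (K' - K) x * transition_op Q u (reach_avoid_value U Q K K' T (Suc k)) x)"
  by (subst reach_avoid_value.simps) simp

(* The Bochner integral is 0 on non-integrable functions, which would make such functions
   spuriously cheap in a minimisation.  The integral over A is therefore taken in the extended
   reals, as positive part minus negative part (it is +\<infinity> in the case \<infinity> - \<infinity>). *)
definition extended_set_integral :: "'a measure \<Rightarrow> 'a set \<Rightarrow> ('a \<Rightarrow> real) \<Rightarrow> ereal" where
  "extended_set_integral M A f =
     enn2ereal (\<integral>\<^sup>+x\<in>A. ennreal (f x) \<partial>M) - enn2ereal (\<integral>\<^sup>+x\<in>A. ennreal (- f x) \<partial>M)"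

(* Functions X \<rightarrow> \<real> are represented by total functions whose values outside X play no role. *)
definition lp_feasible ::
  "(real^'n) set \<Rightarrow> (real^'m) set \<Rightarrow> (real^'n \<Rightarrow> real^'m \<Rightarrow> (real^'n) measure) \<Rightarrow>
   (real^'n) set \<Rightarrow> (real^'n \<Rightarrow> real) \<Rightarrow> (real^'n \<Rightarrow> real) set" where
  "lp_feasible X U Q A W =
     {V \<in> borel_measurable (borel_on X). \<forall>x\<in>A. \<forall>u\<in>U. V x \<ge> transition_op Q u W x}"

definition lp_optimal ::
  "(real^'n) set \<Rightarrow> (real^'m) set \<Rightarrow> (real^'n \<Rightarrow> real^'m \<Rightarrow> (real^'n) measure) \<Rightarrow>
   (real^'n) set \<Rightarrow> (real^'n \<Rightarrow> real) \<Rightarrow> (real^'n) measure \<Rightarrow> (real^'n \<Rightarrow> real) \<Rightarrow> bool" where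
  "lp_optimal X U Q A W \<nu> V \<longleftrightarrow>
     V \<in> lp_feasible X U Q A W \<and>
     extended_set_integral \<nu> A V =
       (INF V'\<in>lp_feasible X U Q A W. extended_set_integral \<nu> A V')"

end

theory Submission imports Defs
begin

text \<open>
  A measurable function with values in \<open>[0,1]\<close> is the uniform limit of staircase functions, so its
  integral is a limit of averages of measures of superlevel sets, uniformly in the measure. Hence
  setwise continuity of the kernel in the control makes \<open>u \<mapsto> \<integral> W(y) Q(dy|x,u)\<close> continuous for
  every such \<open>W\<close>, and the supremum over \<open>U\<close> may be taken over a countable dense subset. By backward
  induction all value functions are measurable. Feasibility says exactly that a measurable function
  dominates the value function on \<open>K' - K\<close>; the value function is therefore the least feasible
  function, and a dominating function with the same finite integral agrees with it almost everywhere.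
\<close>

section \<open>Staircase approximation of integrals\<close>

lemma sum_of_bool_le_eq_floor:
  fixes w :: real
  assumes "0 \<le> w" "w \<le> 1"
  shows "(\<Sum>i\<in>{1..n}. of_bool (real i \<le> real n * w)) = real_of_int \<lfloor>real n * w\<rfloor>"
proof -
  have nw: "real n * w \<le> real n" using assms by (simp add: mult_left_le)
  \<comment> \<open>The indices that count are those up to the floor of \<open>n * w\<close>; since
    \<open>w \<le> 1\<close>, the cut-off at \<open>n\<close> removes none of them.\<close>
  have "{1..n} \<inter> {i. real i \<le> real n * w} = {1..nat \<lfloor>real n * w\<rfloor>}"
    using nw assms by (auto simp: le_nat_floor le_nat_iff le_floor_iff)
  then have "(\<Sum>i\<in>{1..n}. of_bool (real i \<le> real n * w)) = real (nat \<lfloor>real n * w\<rfloor>)"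
    by (simp add: of_bool_def sum.If_cases)
  then show ?thesis using assms by simp
qed

text \<open>For \<open>f\<close> with values in [0,1] this is the integral of the staircase function
  floor(n f)/n. It is written through measures of superlevel sets so that measurability in the state
  and continuity in the control carry over from the kernel.\<close>

definition staircase_mean :: "'a measure \<Rightarrow> ('a \<Rightarrow> real) \<Rightarrow> nat \<Rightarrow> real" where
  "staircase_mean M f n =
     (\<Sum>i\<in>{1..n}. measure M {x \<in> space M. real i \<le> real n * f x}) / real n"

text \<open>Rounding \<open>n * f x\<close> down costs less than 1, hence at most 1/n after
  division, and a probability measure preserves this pointwise bound. The bound involves neither
  \<open>f\<close> nor the measure, which later gives uniformity in the control.\<close>

lemma (in prob_space) staircase_mean_approx:
  assumes [measurable]: "f \<in> borel_measurable M"
    and f: "\<And>x. x \<in> space M \<Longrightarrow> 0 \<le> f x \<and> f x \<le> 1" and "n > 0"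
  shows "\<bar>(\<integral>x. f x \<partial>M) - staircase_mean M f n\<bar> \<le> 1 / real n"
proof -
  let ?A = "\<lambda>i. {x \<in> space M. real i \<le> real n * f x}"
  let ?s = "\<lambda>x. (\<Sum>i\<in>{1..n}. indicator (?A i) x) / real n :: real"
  have int_f: "integrable M f"
    by (rule integrable_const_bound[where B = 1]) (use f in auto)
  have int_s: "integrable M ?s"
    by (intro integrable_divide_zero integrable_sum integrable_real_indicator)
      (auto simp: emeasure_eq_measure)
  have mean: "staircase_mean M f n = (\<integral>x. ?s x \<partial>M)"
  proof -
    have "(\<integral>x. ?s x \<partial>M) = (\<Sum>i\<in>{1..n}. \<integral>x. indicator (?A i) x \<partial>M) / real n"
      by (subst integral_divide_zero, subst Bochner_Integration.integral_sum)
        (auto simp: emeasure_eq_measure intro!: integrable_real_indicator)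
    also have "\<dots> = (\<Sum>i\<in>{1..n}. measure M (?A i)) / real n"
      by (intro arg_cong2[where f = "(/)"] sum.cong refl) (simp add: Int_absorb2)
    finally show ?thesis unfolding staircase_mean_def ..
  qed
  have close: "\<bar>f x - ?s x\<bar> \<le> 1 / real n" if "x \<in> space M" for x
  proof -
    have "(\<Sum>i\<in>{1..n}. indicator (?A i) x) = (\<Sum>i\<in>{1..n}. of_bool (real i \<le> real n * f x) :: real)"
      using that by (intro sum.cong) (auto simp: indicator_def)
    then have "?s x = real_of_int \<lfloor>real n * f x\<rfloor> / real n"
      using sum_of_bool_le_eq_floor f[OF that] by simp
    then have "f x - ?s x = (real n * f x - real_of_int \<lfloor>real n * f x\<rfloor>) / real n"
      using \<open>n > 0\<close> by (simp add: diff_divide_distrib)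
    moreover have "\<bar>real n * f x - real_of_int \<lfloor>real n * f x\<rfloor>\<bar> \<le> 1" by linarith
    ultimately show ?thesis by (simp add: abs_divide divide_right_mono)
  qed
  have "\<bar>(\<integral>x. f x \<partial>M) - staircase_mean M f n\<bar> = \<bar>\<integral>x. f x - ?s x \<partial>M\<bar>"
    unfolding mean using int_f int_s by (simp add: Bochner_Integration.integral_diff)
  also have "\<dots> \<le> (\<integral>x. \<bar>f x - ?s x\<bar> \<partial>M)" by (rule integral_abs_bound)
  also have "\<dots> \<le> (\<integral>x. 1 / real n \<partial>M)"
    by (rule integral_mono) (use int_f int_s close in auto)
  also have "\<dots> = 1 / real n" by (simp add: prob_space)
  finally show ?thesis .
qed

lemma (in prob_space) staircase_mean_tendsto:
  assumes "f \<in> borel_measurable M" "\<And>x. x \<in> space M \<Longrightarrow> 0 \<le> f x \<and> f x \<le> 1"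
  shows "staircase_mean M f \<longlonglongrightarrow> (\<integral>x. f x \<partial>M)"
proof -
  have "\<forall>\<^sub>F n in sequentially. norm (staircase_mean M f n - (\<integral>x. f x \<partial>M)) \<le> 1 / real n"
    using eventually_gt_at_top[of "0::nat"]
    by eventually_elim
      (use staircase_mean_approx[OF assms] in \<open>simp add: abs_minus_commute\<close>)
  then have "(\<lambda>n. staircase_mean M f n - (\<integral>x. f x \<partial>M)) \<longlonglongrightarrow> 0"
    by (rule Lim_null_comparison[OF _ lim_1_over_n])
  then show ?thesis by (rule LIM_zero_cancel)
qed

section \<open>Regularity of the transition operator\<close>

lemma stochastic_kernelD:
  assumes "stochastic_kernel X U Q" "x \<in> X" "u \<in> U"
  shows "prob_space (Q x u)" "sets (Q x u) = sets (borel_on X)" "space (Q x u) = X"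
  using assms sets_eq_imp_space_eq[of "Q x u" "borel_on X"]
  by (auto simp: stochastic_kernel_def space_restrict_space)

lemma stochastic_kernel_measurable_section:
  assumes "stochastic_kernel X U Q" "u \<in> U" "A \<in> sets (borel_on X)"
  shows "(\<lambda>x. measure (Q x u) A) \<in> borel_measurable (borel_on X)"
proof -
  have slice: "(\<lambda>x. (x, u)) \<in> borel_on X \<rightarrow>\<^sub>M borel_on (X \<times> U)"
    using \<open>u \<in> U\<close>
    by (intro measurable_restrict_space2 measurable_restrict_space1)
      (auto simp: space_restrict_space)
  have "(\<lambda>(x, u). measure (Q x u) A) \<in> borel_measurable (borel_on (X \<times> U))"
    using assms by (simp add: stochastic_kernel_def)
  from measurable_compose[OF slice this] show ?thesis by simp
qed

text \<open>Collects what backward induction knows about the next value function; \<open>W\<close>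
  is instantiated with that function.\<close>

locale bounded_kernel_integrand =
  fixes X :: "(real^'n) set" and U :: "(real^'m) set"
    and Q :: "real^'n \<Rightarrow> real^'m \<Rightarrow> (real^'n) measure" and W :: "real^'n \<Rightarrow> real"
  assumes kernel: "stochastic_kernel X U Q"
    and W_measurable: "W \<in> borel_measurable (borel_on X)"
    and W_bounds: "\<And>x. x \<in> X \<Longrightarrow> 0 \<le> W x \<and> W x \<le> 1"
begin

lemma W_measurable_kernel: "x \<in> X \<Longrightarrow> u \<in> U \<Longrightarrow> W \<in> borel_measurable (Q x u)"
  using W_measurable measurable_cong_sets[OF stochastic_kernelD(2)[OF kernel] refl] by blast

lemma superlevel_sets: "{y \<in> X. real i \<le> real n * W y} \<in> sets (borel_on X)"
proof -
  note [measurable] = W_measurable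
  have "{y \<in> space (borel_on X). real i \<le> real n * W y} \<in> sets (borel_on X)" by measurable
  then show ?thesis by (simp add: space_restrict_space)
qed

lemma staircase_mean_kernel:
  "x \<in> X \<Longrightarrow> u \<in> U \<Longrightarrow> staircase_mean (Q x u) W n =
     (\<Sum>i\<in>{1..n}. measure (Q x u) {y \<in> X. real i \<le> real n * W y}) / real n"
  by (simp add: staircase_mean_def stochastic_kernelD(3)[OF kernel])

lemma transition_op_bounds:
  assumes "x \<in> X" "u \<in> U"
  shows "0 \<le> transition_op Q u W x" "transition_op Q u W x \<le> 1"
proof -
  interpret prob_space "Q x u" by (rule stochastic_kernelD(1)[OF kernel assms])
  have W: "0 \<le> W y" "W y \<le> 1" if "y \<in> space (Q x u)" for y
    using that W_bounds stochastic_kernelD(3)[OF kernel assms] by auto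
  have "integrable (Q x u) W"
    by (rule integrable_const_bound[where B = 1]) (use W W_measurable_kernel[OF assms] in auto)
  then show "0 \<le> transition_op Q u W x" "transition_op Q u W x \<le> 1"
    unfolding transition_op_def using W by (auto intro!: integral_nonneg_AE integral_le_const)
qed

text \<open>The staircase means converge pointwise in the state, and each is a finite combination of
  kernel probabilities of sets that do not depend on the state.\<close>

lemma transition_op_measurable:
  assumes "u \<in> U"
  shows "transition_op Q u W \<in> borel_measurable (borel_on X)"
proof (rule borel_measurable_LIMSEQ_real)
  fix x assume "x \<in> space (borel_on X)"
  then have x: "x \<in> X" by (simp add: space_restrict_space)
  interpret prob_space "Q x u" by (rule stochastic_kernelD(1)[OF kernel x assms])
  have "staircase_mean (Q x u) W \<longlonglongrightarrow> transition_op Q u W x"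
    unfolding transition_op_def
    by (rule staircase_mean_tendsto)
      (use W_measurable_kernel[OF x assms] W_bounds stochastic_kernelD(3)[OF kernel x assms] in auto)
  then show "(\<lambda>n. (\<Sum>i\<in>{1..n}. measure (Q x u) {y \<in> X. real i \<le> real n * W y}) / real n)
      \<longlonglongrightarrow> transition_op Q u W x"
    unfolding ext[OF staircase_mean_kernel[OF x assms]] .
next
  fix n
  show "(\<lambda>x. (\<Sum>i\<in>{1..n}. measure (Q x u) {y \<in> X. real i \<le> real n * W y}) / real n)
      \<in> borel_measurable (borel_on X)"
    by (intro borel_measurable_divide borel_measurable_sum borel_measurable_const
        stochastic_kernel_measurable_section[OF kernel assms] superlevel_sets)
qed

text \<open>Each staircase mean inherits continuity from finitely many sets, and the error 1/n is
  the same for all controls, so the limit is uniform.\<close>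

lemma transition_op_continuous:
  assumes "x \<in> X" and "\<forall>A\<in>sets (borel_on X). continuous_on U (\<lambda>u. measure (Q x u) A)"
  shows "continuous_on U (\<lambda>u. transition_op Q u W x)"
proof (rule uniform_limit_theorem)
  let ?s = "\<lambda>n u. (\<Sum>i\<in>{1..n}. measure (Q x u) {y \<in> X. real i \<le> real n * W y}) / real n"
  have "continuous_on U (?s n)" for n
    \<comment> \<open>Continuity of the quotient needs a nonzero denominator; for
      \<open>n = 0\<close> the function is constantly 0.\<close>
    using assms(2) superlevel_sets by (cases "n = 0") (auto intro!: continuous_intros)
  then show "\<forall>\<^sub>F n in sequentially. continuous_on U (?s n)" by simp
  show "uniform_limit U ?s (\<lambda>u. transition_op Q u W x) sequentially"
  proof (rule uniform_limitI)
    fix e :: real assume "e > 0"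
    have "\<forall>\<^sub>F n in sequentially. 1 / real n < e"
      using lim_1_over_n \<open>e > 0\<close> by (rule order_tendstoD(2))
    then show "\<forall>\<^sub>F n in sequentially. \<forall>u\<in>U. dist (?s n u) (transition_op Q u W x) < e"
      using eventually_gt_at_top[of "0::nat"]
    proof eventually_elim
      case (elim n)
      show ?case
      proof
        fix u assume u: "u \<in> U"
        interpret prob_space "Q x u" by (rule stochastic_kernelD(1)[OF kernel \<open>x \<in> X\<close> u])
        have "\<bar>transition_op Q u W x - staircase_mean (Q x u) W n\<bar> \<le> 1 / real n"
          unfolding transition_op_def
          by (rule staircase_mean_approx)
            (use elim W_measurable_kernel[OF \<open>x \<in> X\<close> u] W_bounds
              stochastic_kernelD(3)[OF kernel \<open>x \<in> X\<close> u] in auto)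
        then show "dist (?s n u) (transition_op Q u W x) < e"
          using elim staircase_mean_kernel[OF \<open>x \<in> X\<close> u]
          by (simp add: dist_real_def abs_minus_commute)
      qed
    qed
  qed
qed simp

end

section \<open>Measurability and bounds of the value functions\<close>

lemma cSUP_dense_eq:
  fixes g :: "'a::topological_space \<Rightarrow> real"
  assumes "continuous_on (closure D) g" "D \<noteq> {}" "bdd_above (g ` closure D)"
  shows "(SUP u\<in>closure D. g u) = (SUP u\<in>D. g u)"
proof (rule antisym)
  have bdd: "bdd_above (g ` D)"
    by (rule bdd_above_mono[OF assms(3) image_mono[OF closure_subset]])
  show "(SUP u\<in>closure D. g u) \<le> (SUP u\<in>D. g u)"
  proof (rule cSUP_least)
    fix u assume "u \<in> closure D"
    then show "g u \<le> (SUP u\<in>D. g u)"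
      \<comment> \<open>By continuity, an upper bound valid on \<open>D\<close> persists on its
        closure.\<close>
      by (rule continuous_le_on_closure[OF assms(1)]) (rule cSUP_upper[OF _ bdd])
  qed (use assms in auto)
  show "(SUP u\<in>D. g u) \<le> (SUP u\<in>closure D. g u)"
    using assms closure_subset by (intro cSUP_subset_mono) auto
qed

text \<open>Measurability and bounds are proved together because the induction step needs both for
  the next value function: without them its integral would not be controlled.\<close>

lemma reach_avoid_value_regular:
  fixes Q :: "real^'n \<Rightarrow> real^'m \<Rightarrow> (real^'n) measure"
  assumes "compact U" "U \<noteq> {}" and kernel: "stochastic_kernel X U Q"
    and K: "K \<in> sets (borel_on X)" and K': "K' \<in> sets (borel_on X)"
    and cont: "\<forall>x\<in>X. \<forall>A\<in>sets (borel_on X). continuous_on U (\<lambda>u. measure (Q x u) A)"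
    and "k \<le> T"
  shows "reach_avoid_value U Q K K' T k \<in> borel_measurable (borel_on X) \<and>
    (\<forall>x\<in>X. 0 \<le> reach_avoid_value U Q K K' T k x \<and> reach_avoid_value U Q K K' T k x \<le> 1)"
  using \<open>k \<le> T\<close>
proof (induction rule: inc_induct)
  case base
  have "reach_avoid_value U Q K K' T T = indicator K"
    by (rule ext) (rule reach_avoid_value_horizon)
  then show ?case using K by auto
next
  case (step k)
  let ?W = "reach_avoid_value U Q K K' T (Suc k)"
  let ?g = "\<lambda>u x. indicator K x + indicator (K' - K) x * transition_op Q u ?W x"
  interpret bounded_kernel_integrand X U Q ?W
    using kernel step.IH by unfold_locales auto
  have eq: "reach_avoid_value U Q K K' T k x = (SUP u\<in>U. ?g u x)" for x
    using step.hyps by (simp add: reach_avoid_value_step)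
  have g: "0 \<le> ?g u x" "?g u x \<le> 1" if "x \<in> X" "u \<in> U" for x u
    using transition_op_bounds[OF that] by (auto simp: indicator_def)
  have bdd: "bdd_above ((\<lambda>u. ?g u x) ` U)" if "x \<in> X" for x
    using g(2)[OF that] by (auto intro!: bdd_aboveI2)
  obtain D where D: "countable D" "D \<subseteq> U" "U \<subseteq> closure D"
    using separable by blast
  \<comment> \<open>\<open>U\<close> is closed, so the closure of \<open>D\<close> does not leave
    the set on which continuity is known.\<close>
  have "closure D = U"
    using D closure_minimal[OF D(2)] compact_imp_closed[OF \<open>compact U\<close>] by blast
  have "D \<noteq> {}" using D \<open>U \<noteq> {}\<close> by auto
  have dense: "(SUP u\<in>U. ?g u x) = (SUP u\<in>D. ?g u x)" if "x \<in> X" for x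
  proof -
    have "continuous_on U (\<lambda>u. ?g u x)"
      using transition_op_continuous[OF that] cont that by (intro continuous_intros) auto
    then show ?thesis
      using cSUP_dense_eq[of D "\<lambda>u. ?g u x"] bdd[OF that] \<open>closure D = U\<close> \<open>D \<noteq> {}\<close> by simp
  qed
  have "(\<lambda>x. SUP u\<in>D. ?g u x) \<in> borel_measurable (borel_on X)"
  proof (rule borel_measurable_cSUP[OF D(1)])
    fix u assume "u \<in> D"
    then show "?g u \<in> borel_measurable (borel_on X)"
      using D(2) K K' by (intro borel_measurable_add borel_measurable_times
          borel_measurable_indicator transition_op_measurable) auto
  next
    fix x assume "x \<in> space (borel_on X)"
    then show "bdd_above ((\<lambda>u. ?g u x) ` D)"
      using bdd_above_mono[OF bdd image_mono[OF D(2)]] by (simp add: space_restrict_space)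
  qed
  moreover have "reach_avoid_value U Q K K' T k x = (SUP u\<in>D. ?g u x)"
    if "x \<in> space (borel_on X)" for x
    using that dense by (simp add: eq space_restrict_space)
  ultimately have "reach_avoid_value U Q K K' T k \<in> borel_measurable (borel_on X)"
    by (subst measurable_cong) auto
  moreover have "0 \<le> (SUP u\<in>U. ?g u x)" "(SUP u\<in>U. ?g u x) \<le> 1" if "x \<in> X" for x
  proof -
    obtain u where "u \<in> U" using \<open>U \<noteq> {}\<close> by blast
    then show "0 \<le> (SUP u\<in>U. ?g u x)"
      using g(1)[OF that] by (intro cSUP_upper2[OF bdd[OF that]])
    show "(SUP u\<in>U. ?g u x) \<le> 1"
      using g(2)[OF that] \<open>U \<noteq> {}\<close> by (intro cSUP_least)
  qed
  ultimately show ?case unfolding eq[symmetric] by blast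
qed

section \<open>Comparison of extended integrals\<close>

lemma extended_set_integral_mono:
  assumes "\<And>x. x \<in> A \<Longrightarrow> f x \<le> g x"
  shows "extended_set_integral M A f \<le> extended_set_integral M A g"
  unfolding extended_set_integral_def
  using assms
  \<comment> \<open>A larger function has a larger positive and a smaller negative part; no
    integrability is required, since the convention for \<infinity> - \<infinity> respects this
    order.\<close>
  by (intro ereal_minus_mono)
    (auto simp: less_eq_ennreal.rep_eq[symmetric] indicator_def intro!: nn_integral_mono ennreal_leI)

lemma extended_set_integral_nonneg:
  assumes "\<And>x. x \<in> A \<Longrightarrow> 0 \<le> f x"
  shows "extended_set_integral M A f = enn2ereal (\<integral>\<^sup>+x\<in>A. ennreal (f x) \<partial>M)"
proof -
  have "(\<integral>\<^sup>+x\<in>A. ennreal (- f x) \<partial>M) = (\<integral>\<^sup>+x. 0 \<partial>M)"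
    using assms by (intro nn_integral_cong) (auto simp: indicator_def ennreal_neg)
  then show ?thesis by (simp add: extended_set_integral_def zero_ennreal.rep_eq)
qed

text \<open>The nonnegative difference \<open>g - f\<close> has integral zero over \<open>A\<close>.
  Finiteness of the integral of \<open>f\<close> makes the subtraction of integrals
  legitimate.\<close>

lemma AE_eq_if_le_extended_set_integral_eq:
  assumes [measurable]: "A \<in> sets M" "f \<in> borel_measurable M" "g \<in> borel_measurable M"
    and f: "\<And>x. x \<in> A \<Longrightarrow> 0 \<le> f x" and le: "\<And>x. x \<in> A \<Longrightarrow> f x \<le> g x"
    and fin: "(\<integral>\<^sup>+x\<in>A. ennreal (f x) \<partial>M) \<noteq> \<infinity>"
    and eq: "extended_set_integral M A g = extended_set_integral M A f"
  shows "AE x in M. x \<in> A \<longrightarrow> g x = f x"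
proof -
  have g: "0 \<le> g x" if "x \<in> A" for x using f[OF that] le[OF that] by simp
  have int_eq: "(\<integral>\<^sup>+x\<in>A. ennreal (g x) \<partial>M) = (\<integral>\<^sup>+x\<in>A. ennreal (f x) \<partial>M)"
    using eq by (simp add: extended_set_integral_nonneg f g enn2ereal_inject)
  have "(\<integral>\<^sup>+x. ennreal (g x) * indicator A x - ennreal (f x) * indicator A x \<partial>M)
      = (\<integral>\<^sup>+x\<in>A. ennreal (g x) \<partial>M) - (\<integral>\<^sup>+x\<in>A. ennreal (f x) \<partial>M)"
    using fin le by (intro nn_integral_diff) (auto simp: indicator_def intro!: ennreal_leI)
  also have "\<dots> = 0" using fin int_eq by (simp add: less_top)
  finally have "AE x in M. ennreal (g x) * indicator A x - ennreal (f x) * indicator A x = 0"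
    by (subst (asm) nn_integral_0_iff_AE) auto
  then show ?thesis
  proof (rule AE_mp, intro AE_I2 impI)
    fix x assume "ennreal (g x) * indicator A x - ennreal (f x) * indicator A x = 0" and x: "x \<in> A"
    \<comment> \<open>Subtraction in \<open>ennreal\<close> truncates at 0, so this yields only
      \<open>g x \<le> f x\<close>; \<open>le\<close> supplies the converse.\<close>
    then have "ennreal (g x - f x) = 0" using f[OF x] by (simp add: ennreal_minus)
    then show "g x = f x" using le[OF x] by (simp add: ennreal_eq_0_iff)
  qed
qed

section \<open>The linear program\<close>

theorem theorem1:
  fixes X K K' :: "(real^'n) set"
    and U :: "(real^'m) set"
    and Q :: "real^'n \<Rightarrow> real^'m \<Rightarrow> (real^'n) measure"
    and T k :: nat
    and \<nu> :: "(real^'n) measure"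
  assumes "compact U" and "U \<noteq> {}"
    and "stochastic_kernel X U Q"
    and "K \<in> sets (borel_on X)" and "K' \<in> sets (borel_on X)" and "K \<subseteq> K'"
    and "\<forall>x\<in>X. \<forall>A\<in>sets (borel_on X). continuous_on U (\<lambda>u. measure (Q x u) A)"
    and "k < T"
    and "finite_measure \<nu>" and "sets \<nu> = sets (borel_on X)"
    and "emeasure \<nu> (X - (K' - K)) = 0"
  shows "(\<forall>V \<in> lp_feasible X U Q (K' - K) (reach_avoid_value U Q K K' T (Suc k)).
            \<forall>x \<in> K' - K. V x \<ge> reach_avoid_value U Q K K' T k x) \<and>
         lp_optimal X U Q (K' - K) (reach_avoid_value U Q K K' T (Suc k)) \<nu>
            (reach_avoid_value U Q K K' T k) \<and>
         (\<forall>V. lp_optimal X U Q (K' - K) (reach_avoid_value U Q K K' T (Suc k)) \<nu> V \<longrightarrow>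
            (AE x in \<nu>. x \<in> K' - K \<longrightarrow> V x = reach_avoid_value U Q K K' T k x))"
proof -
  let ?A = "K' - K"
  let ?W = "reach_avoid_value U Q K K' T (Suc k)"
  let ?V = "reach_avoid_value U Q K K' T k"
  let ?F = "lp_feasible X U Q ?A ?W"
  note regular = reach_avoid_value_regular[OF assms(1-5) assms(7)]
  interpret finite_measure \<nu> by (rule assms(9))
  have A_sets: "?A \<in> sets (borel_on X)" using assms(4,5) by auto
  then have "?A \<subseteq> X" using sets.sets_into_space by (fastforce simp: space_restrict_space)
  have V_meas: "?V \<in> borel_measurable (borel_on X)" using regular assms(8) by simp
  have V_bounds: "0 \<le> ?V x" "?V x \<le> 1" if "x \<in> ?A" for x
    using regular[of k T] assms(8) that \<open>?A \<subseteq> X\<close> by auto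
  interpret bounded_kernel_integrand X U Q ?W
    using assms(3) regular[of "Suc k" T] assms(8) by unfold_locales auto
  \<comment> \<open>On \<open>?A\<close> the indicator of \<open>K\<close> is 0 and that of
    \<open>K' - K\<close> is 1.\<close>
  have V_eq: "?V x = (SUP u\<in>U. transition_op Q u ?W x)" if "x \<in> ?A" for x
    using that by (simp add: reach_avoid_value_step[OF assms(8)])
  have upper: "?V x \<le> V x" if "V \<in> ?F" "x \<in> ?A" for V x
    unfolding V_eq[OF that(2)] using that assms(2)
    by (intro cSUP_least) (auto simp: lp_feasible_def)
  have feasible: "?V \<in> ?F"
  proof -
    have "transition_op Q u ?W x \<le> ?V x" if "x \<in> ?A" "u \<in> U" for x u
      unfolding V_eq[OF that(1)]
      \<comment> \<open>A real supremum dominates its family only if that family is bounded above;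
        the bound here is 1.\<close>
      using that(2) transition_op_bounds(2) that(1) \<open>?A \<subseteq> X\<close>
      by (intro cSUP_upper) (auto intro!: bdd_aboveI2)
    then show ?thesis using V_meas by (auto simp: lp_feasible_def)
  qed
  \<comment> \<open>\<open>?V\<close> is itself feasible and lies below every feasible function on
    \<open>?A\<close>, so the infimum is attained there, whatever \<nu> is.\<close>
  have optimal_value: "(INF V\<in>?F. extended_set_integral \<nu> ?A V) = extended_set_integral \<nu> ?A ?V"
    by (intro antisym INF_lower feasible INF_greatest extended_set_integral_mono upper)
  have fin: "(\<integral>\<^sup>+x\<in>?A. ennreal (?V x) \<partial>\<nu>) \<noteq> \<infinity>"
  proof -
    have "(\<integral>\<^sup>+x\<in>?A. ennreal (?V x) \<partial>\<nu>) \<le> (\<integral>\<^sup>+x. 1 \<partial>\<nu>)"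
      using V_bounds by (intro nn_integral_mono) (auto simp: indicator_def)
    also have "\<dots> < \<infinity>" by (simp add: less_top[symmetric])
    finally show ?thesis by simp
  qed
  have meas_\<nu>: "f \<in> borel_measurable \<nu>" if "f \<in> borel_measurable (borel_on X)" for f :: "real^'n \<Rightarrow> real"
    using that measurable_cong_sets[OF assms(10) refl] by blast
  \<comment> \<open>An optimal \<open>V\<close> is feasible, so it dominates \<open>?V\<close> on
    \<open>?A\<close>, and it has the same finite integral.\<close>
  have unique: "AE x in \<nu>. x \<in> ?A \<longrightarrow> V x = ?V x" if "lp_optimal X U Q ?A ?W \<nu> V" for V
  proof (rule AE_eq_if_le_extended_set_integral_eq)
    have V: "V \<in> ?F" using that by (simp add: lp_optimal_def)
    show "V \<in> borel_measurable \<nu>" using V by (intro meas_\<nu>) (simp add: lp_feasible_def)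
    show "?V x \<le> V x" if "x \<in> ?A" for x by (rule upper[OF V that])
    show "extended_set_integral \<nu> ?A V = extended_set_integral \<nu> ?A ?V"
      using that optimal_value by (simp add: lp_optimal_def)
  qed (use A_sets assms(10) fin V_bounds meas_\<nu>[OF V_meas] in auto)
  show ?thesis
    using upper feasible optimal_value unique by (auto simp: lp_optimal_def)
qed

end
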